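(* Let $n>1$ be an integer. The chromatic number of the zero-divisor graph $\Gamma(\mathbb{Z}_{2^n}[i])$ is $2^n-1$.
   Context: $\mathbb{Z}_{2^n}[i]=\{a+ib: a,b\in\mathbb{Z}_{2^n}\}\cong \mathbb{Z}[i]/\langle 2^n\rangle$ is the ring of Gaussian integers modulo $2^n$. For a commutative ring $R$, the zero-divisor graph $\Gamma(R)$ is the simple graph whose vertex set is the set $\mathcal{Z}(R)$ of nonzero zero-divisors of $R$, two distinct vertices $x,y$ being adjacent if and only if $xy=0$. *)

theory Defs
  imports "HOL-Number_Theory.Residues" "HOL-Library.Extended_Nat" "Graph_Theory.Pair_Digraph"
begin

section \<open>Gaussian integers modulo \<open>m\<close>\<close>

text \<open>
  For a commutative ring \<open>R\<close>, the ring \<open>R[i]\<close> of formal sums \<open>a + i b\<close> with \<open>a, b\<close> in \<open>R\<close>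
  and \<open>i\<^sup>2 = -1\<close>; the pair \<open>(a, b)\<close> stands for \<open>a + i b\<close>.
\<close>

definition gaussian_extension :: "('a, 'b) ring_scheme \<Rightarrow> ('a \<times> 'a) ring" where
  "gaussian_extension R =
    \<lparr> carrier = carrier R \<times> carrier R,
      monoid.mult = (\<lambda>(a, b) (c, d).
        ((a \<otimes>\<^bsub>R\<^esub> c) \<ominus>\<^bsub>R\<^esub> (b \<otimes>\<^bsub>R\<^esub> d), (a \<otimes>\<^bsub>R\<^esub> d) \<oplus>\<^bsub>R\<^esub> (b \<otimes>\<^bsub>R\<^esub> c))),
      one = (\<one>\<^bsub>R\<^esub>, \<zero>\<^bsub>R\<^esub>),
      zero = (\<zero>\<^bsub>R\<^esub>, \<zero>\<^bsub>R\<^esub>),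
      add = (\<lambda>(a, b) (c, d). (a \<oplus>\<^bsub>R\<^esub> c, b \<oplus>\<^bsub>R\<^esub> d)) \<rparr>"

definition gaussian_residue_ring :: "int \<Rightarrow> (int \<times> int) ring" where
  "gaussian_residue_ring m = gaussian_extension (residue_ring m)"

lemma cring_gaussian_extension:
  assumes "cring R"
  shows "cring (gaussian_extension R)"
proof -
  interpret cring R by (fact assms)
  show ?thesis
  proof (rule cringI)
    show "abelian_group (gaussian_extension R)"
    proof (rule abelian_groupI)
      fix x assume "x \<in> carrier (gaussian_extension R)"
      then show "\<exists>y\<in>carrier (gaussian_extension R).
          y \<oplus>\<^bsub>gaussian_extension R\<^esub> x = \<zero>\<^bsub>gaussian_extension R\<^esub>"
        by (intro bexI[of _ "(\<ominus>\<^bsub>R\<^esub> fst x, \<ominus>\<^bsub>R\<^esub> snd x)"])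
           (auto simp: gaussian_extension_def l_neg)
    qed (auto simp: gaussian_extension_def a_ac)
    show "comm_monoid (gaussian_extension R)"
      by (rule comm_monoidI)
         (auto simp: gaussian_extension_def minus_eq l_distr r_distr minus_add l_minus r_minus a_ac m_ac)
  qed (auto simp: gaussian_extension_def minus_eq l_distr r_distr minus_add l_minus r_minus a_ac m_ac)
qed

lemma cring_gaussian_residue_ring: "m > 1 \<Longrightarrow> cring (gaussian_residue_ring m)"
  unfolding gaussian_residue_ring_def
  by (intro cring_gaussian_extension residues.cring) (simp add: residues_def)


section \<open>Zero-divisor graphs\<close>

definition nonzero_zero_divisors :: "('a, 'b) ring_scheme \<Rightarrow> 'a set" where
  "nonzero_zero_divisors R =
    {x \<in> carrier R - {\<zero>\<^bsub>R\<^esub>}. \<exists>y \<in> carrier R - {\<zero>\<^bsub>R\<^esub>}. x \<otimes>\<^bsub>R\<^esub> y = \<zero>\<^bsub>R\<^esub>}"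

text \<open>
  An undirected edge between \<open>x\<close> and \<open>y\<close> is represented by the two arcs \<open>(x, y)\<close> and \<open>(y, x)\<close>.
\<close>

definition zero_divisor_graph :: "('a, 'b) ring_scheme \<Rightarrow> 'a pair_pre_digraph" where
  "zero_divisor_graph R =
    \<lparr> pverts = nonzero_zero_divisors R,
      parcs = {(x, y). x \<in> nonzero_zero_divisors R \<and> y \<in> nonzero_zero_divisors R \<and>
                       x \<noteq> y \<and> x \<otimes>\<^bsub>R\<^esub> y = \<zero>\<^bsub>R\<^esub>} \<rparr>"

lemma pair_graph_zero_divisor_graph:
  assumes "cring R" "finite (carrier R)"
  shows "pair_graph (zero_divisor_graph R)"
proof -
  interpret cring R by (fact assms)
  have sub: "nonzero_zero_divisors R \<subseteq> carrier R"
    by (auto simp: nonzero_zero_divisors_def)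
  then have fin: "finite (nonzero_zero_divisors R)"
    using assms(2) by (rule finite_subset)
  have "finite (parcs (zero_divisor_graph R))"
    by (rule finite_subset[OF _ finite_cartesian_product[OF fin fin]])
       (auto simp: zero_divisor_graph_def)
  with fin sub show ?thesis
    by unfold_locales
       (auto simp: zero_divisor_graph_def symmetric_def sym_def m_comm subset_iff)
qed


section \<open>Chromatic number\<close>

definition colourable :: "'a pair_pre_digraph \<Rightarrow> nat \<Rightarrow> bool" where
  "colourable G k \<longleftrightarrow>
    (\<exists>c. c \<in> pverts G \<rightarrow> {..<k} \<and> (\<forall>(u, v) \<in> parcs G. c u \<noteq> c v))"

text \<open>The value is \<open>\<infinity>\<close> if there is no proper colouring with finitely many colours.\<close>

definition chromatic_number :: "'a pair_pre_digraph \<Rightarrow> enat" where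
  "chromatic_number G = Inf {enat k | k. colourable G k}"

end

theory Submission
  imports Defs
begin

text \<open>
  The ring \<open>\<int>[i]/(2\<^sup>n)\<close> is \<open>\<int>[i]/(\<pi>\<^bsup>2n\<^esup>)\<close> for the prime \<open>\<pi> = 1 + i\<close>, so two elements annihilate
  each other iff their \<open>\<pi>\<close>-adic valuations add up to at least \<open>2n\<close>. The \<open>2\<^sup>n - 1\<close> nonzero
  elements of valuation at least \<open>n\<close> form a clique. The vertices of valuation less than \<open>n\<close>
  are pairwise non-adjacent and not adjacent to any element of valuation exactly \<open>n\<close>, so they
  can all share the colour of one such element. As \<open>\<pi>\<close> has norm \<open>2\<close>, the valuation of \<open>a + i b\<close>
  is the 2-adic valuation of \<open>a\<^sup>2 + b\<^sup>2\<close>.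
\<close>

section \<open>Colourings determined by a clique\<close>

text \<open>Every proper colouring is injective on the clique \<open>I\<close>, which bounds the
  number of colours from below. Conversely, \<open>I\<close> is coloured bijectively and all
  vertices outside it take the colour of \<open>p\<close>.\<close>

lemma chromatic_number_eq_card_clique:
  assumes fin: "finite I" and p: "p \<in> I" and sub: "I \<subseteq> pverts G"
    and arcs: "parcs G \<subseteq> pverts G \<times> pverts G"
    and clique: "\<And>u v. u \<in> I \<Longrightarrow> v \<in> I \<Longrightarrow> u \<noteq> v \<Longrightarrow> (u, v) \<in> parcs G"
    and loopless: "\<And>u. (u, u) \<notin> parcs G"
    and indep: "\<And>u v. u \<in> pverts G - I \<Longrightarrow> v \<in> insert p (pverts G - I) \<Longrightarrow>
                  (u, v) \<notin> parcs G \<and> (v, u) \<notin> parcs G"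
  shows "chromatic_number G = enat (card I)"
proof -
  obtain h where h: "bij_betw h I {..<card I}"
    using ex_bij_betw_finite_nat[OF fin] by (auto simp: atLeast0LessThan)
  define r where "r u = (if u \<in> I then u else p)" for u
  have rI: "r u \<in> I" for u
    using p by (simp add: r_def)
  have "h (r u) \<noteq> h (r v)" if uv: "(u, v) \<in> parcs G" for u v
  proof
    assume "h (r u) = h (r v)"
    with h rI have "r u = r v"
      by (auto simp: bij_betw_def dest: inj_onD)
    \<comment> \<open>Two ends of an arc with the same image under \<open>r\<close> are equal, or
      both lie outside \<open>I\<close>, or one is \<open>p\<close> and the other lies outside
      \<open>I\<close>.\<close>
    with uv arcs indep[of u v] indep[of v u] loopless show False
      by (auto simp: r_def split: if_splits)
  qed
  moreover have "h (r u) < card I" for u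
    using h rI[of u] by (auto simp: bij_betw_def)
  ultimately have "colourable G (card I)"
    unfolding colourable_def by (intro exI[of _ "h \<circ> r"]) auto
  moreover have "card I \<le> k" if k: "colourable G k" for k
  proof -
    obtain c where c: "c \<in> pverts G \<rightarrow> {..<k}" "\<forall>(u, v) \<in> parcs G. c u \<noteq> c v"
      using k unfolding colourable_def by blast
    have "inj_on c I"
      using c(2) clique by (fast intro: inj_onI)
    moreover have "c ` I \<subseteq> {..<k}"
      using c(1) sub by auto
    ultimately show ?thesis
      using card_inj_on_le[of c I "{..<k}"] by simp
  qed
  ultimately show ?thesis
    unfolding chromatic_number_def
    by (intro antisym Inf_lower Inf_greatest) auto
qed

section \<open>Products and norms of Gaussian integers\<close>

lemma gaussian_residue_ring_simps:
  "carrier (gaussian_residue_ring m) = {0..m - 1} \<times> {0..m - 1}"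
  "\<zero>\<^bsub>gaussian_residue_ring m\<^esub> = (0, 0)"
  by (auto simp: gaussian_residue_ring_def gaussian_extension_def residue_ring_def)

lemma gaussian_residue_ring_mult_eq_zero_iff:
  assumes "m > 1"
  shows "(a, b) \<otimes>\<^bsub>gaussian_residue_ring m\<^esub> (c, d) = \<zero>\<^bsub>gaussian_residue_ring m\<^esub> \<longleftrightarrow>
    m dvd a * c - b * d \<and> m dvd a * d + b * c"
proof -
  interpret residues m "residue_ring m"
    using assms by (simp_all add: residues_def)
  have "(a * c mod m \<ominus>\<^bsub>residue_ring m\<^esub> b * d mod m) = (a * c - b * d) mod m"
    by (simp add: a_minus_def res_neg_eq res_add_eq mod_simps)
  then show ?thesis
    by (simp add: gaussian_residue_ring_def gaussian_extension_def res_mult_eq res_add_eq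
        res_zero_eq mod_simps dvd_eq_mod_eq_0)
qed

lemma gaussian_norm_mult:
  fixes a b c d :: int
  shows "(a * c - b * d)\<^sup>2 + (a * d + b * c)\<^sup>2 = (a\<^sup>2 + b\<^sup>2) * (c\<^sup>2 + d\<^sup>2)"
  by (simp add: power2_eq_square algebra_simps)

lemma gaussian_norm_dvd:
  fixes a b c d m :: int
  assumes "m dvd a * c - b * d" "m dvd a * d + b * c"
  shows "m\<^sup>2 dvd (a\<^sup>2 + b\<^sup>2) * (c\<^sup>2 + d\<^sup>2)"
  unfolding gaussian_norm_mult[symmetric]
  by (rule dvd_add[OF dvd_power_same dvd_power_same]) (use assms in auto)

section \<open>Norms divisible by powers of two\<close>

text \<open>An even sum of squares has terms of equal parity, and two odd squares add up to 2 modulo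
  4.\<close>

lemma sum_squares_mod_4:
  fixes a b :: int
  assumes "4 dvd a\<^sup>2 + b\<^sup>2"
  shows "even a \<and> even b"
proof (rule ccontr)
  assume *: "\<not> (even a \<and> even b)"
  have "even (a\<^sup>2 + b\<^sup>2)"
    using assms by (rule dvd_trans[rotated]) simp
  with * have "odd a" "odd b"
    by auto
  then obtain s t where "a = 2 * s + 1" "b = 2 * t + 1"
    by (auto elim!: oddE)
  then have "a\<^sup>2 + b\<^sup>2 = 4 * (s\<^sup>2 + s + t\<^sup>2 + t) + 2"
    by (simp add: power2_eq_square algebra_simps)
  with assms show False
    by presburger
qed

text \<open>Induction in steps of two: from exponent 2 on both coordinates are even, and halving
  them divides the norm by 4. Exponent 1 is a matter of parity.\<close>

lemma power_two_dvd_norm_imp: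
  fixes a b :: int
  assumes "2 ^ n dvd a\<^sup>2 + b\<^sup>2"
  shows "2 ^ (n div 2) dvd a \<and> 2 ^ (n - n div 2) dvd a - b"
  using assms
proof (induction n arbitrary: a b rule: induct_nat_012)
  case (ge2 n)
  have "4 dvd a\<^sup>2 + b\<^sup>2"
    using ge2.prems by (rule dvd_trans[rotated]) simp
  then obtain s t where st: "a = 2 * s" "b = 2 * t"
    using sum_squares_mod_4 by (blast elim: evenE)
  have "4 * 2 ^ n dvd 4 * (s\<^sup>2 + t\<^sup>2)"
    using ge2.prems by (simp add: st power_mult_distrib algebra_simps)
  then have "2 ^ n dvd s\<^sup>2 + t\<^sup>2"
    by (subst (asm) dvd_mult_cancel_left) simp
  from ge2.IH(1)[OF this]
  have "2 * 2 ^ (n div 2) dvd 2 * s \<and> 2 * 2 ^ (n - n div 2) dvd 2 * (s - t)"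
    by (meson dvd_refl mult_dvd_mono)
  moreover have "Suc (Suc n) - Suc (Suc n) div 2 = Suc (n - n div 2)"
    by simp
  ultimately show ?case
    by (simp add: st algebra_simps)
qed simp_all

text \<open>The hypotheses describe the multiples of the \<open>n\<close>-th power of \<pi> = 1 + i,
  and the \<open>2n\<close>-th power of \<pi> is \<open>2 ^ n\<close> up to a unit. The proof stays
  in the integers and expands both coordinates of the product in \<open>a\<close>,
  \<open>a - b\<close>, \<open>c\<close> and \<open>c - d\<close>.\<close>

lemma gaussian_mult_dvd:
  fixes a b c d :: int
  assumes x: "2 ^ (n div 2) dvd a" "2 ^ (n - n div 2) dvd a - b"
    and y: "2 ^ (n div 2) dvd c" "2 ^ (n - n div 2) dvd c - d"
  shows "2 ^ n dvd a * c - b * d" "2 ^ n dvd a * d + b * c"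
proof -
  have mixed: "2 ^ n dvd u * v"
    if "2 ^ (n div 2) dvd u" "2 ^ (n - n div 2) dvd v" for u v :: int
    using mult_dvd_mono[OF that] by (simp flip: power_add)
  have "(2::int) ^ (n div 2) dvd 2 ^ (n - n div 2)"
    by (intro le_imp_power_dvd) simp
  then have x': "2 ^ (n div 2) dvd a - b"
    using x(2) by (rule dvd_trans)
  have "2 ^ n dvd a * (c - d) + c * (a - b) - (a - b) * (c - d)"
    by (rule dvd_diff[OF dvd_add[OF mixed[OF x(1) y(2)] mixed[OF y(1) x(2)]] mixed[OF x' y(2)]])
  then show "2 ^ n dvd a * c - b * d"
    by (simp add: algebra_simps)
  have "(2::int) ^ (n - n div 2) dvd 2 ^ Suc (n div 2)"
    by (intro le_imp_power_dvd) simp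
  also have "2 ^ Suc (n div 2) dvd 2 * c"
    using y(1) by simp
  finally have y': "2 ^ (n - n div 2) dvd 2 * c" .
  have "2 ^ n dvd a * (2 * c) - a * (c - d) - c * (a - b)"
    by (rule dvd_diff[OF dvd_diff[OF mixed[OF x(1) y'] mixed[OF x(1) y(2)]] mixed[OF y(1) x(2)]])
  then show "2 ^ n dvd a * d + b * c"
    by (simp add: algebra_simps)
qed

lemma power_two_dvd_norm_iff:
  fixes a b :: int
  shows "2 ^ n dvd a\<^sup>2 + b\<^sup>2 \<longleftrightarrow> 2 ^ (n div 2) dvd a \<and> 2 ^ (n - n div 2) dvd a - b"
proof
  assume *: "2 ^ (n div 2) dvd a \<and> 2 ^ (n - n div 2) dvd a - b"
  \<comment> \<open>Squaring \<open>a + i b\<close> controls \<open>2 * a * b\<close>, and the norm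
    is \<open>(a - b)\<^sup>2 + 2 * a * b\<close>.\<close>
  then have "2 ^ n dvd a * b + b * a" "2 ^ n dvd a * a - b * b"
    using gaussian_mult_dvd[of n a b a b] by auto
  have "(2::int) ^ (n div 2) dvd 2 ^ (n - n div 2)"
    by (intro le_imp_power_dvd) simp
  then have "(2::int) ^ (n div 2) * 2 ^ (n - n div 2) dvd (a - b) * (a - b)"
    using * by (meson dvd_trans mult_dvd_mono)
  then have "2 ^ n dvd (a - b) * (a - b)"
    by (simp flip: power_add)
  then have "2 ^ n dvd (a - b) * (a - b) + (a * b + b * a)"
    using \<open>2 ^ n dvd a * b + b * a\<close> by (rule dvd_add)
  then show "2 ^ n dvd a\<^sup>2 + b\<^sup>2"
    by (simp add: algebra_simps power2_eq_square)
qed (rule power_two_dvd_norm_imp)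

text \<open>The annihilator of \<open>\<pi>\<^sup>n\<close>, which is also the ideal generated by \<open>\<pi>\<^sup>n\<close>.\<close>

definition half_ideal :: "nat \<Rightarrow> (int \<times> int) set" where
  "half_ideal n = {(a, b). a \<in> {0..2 ^ n - 1} \<and> b \<in> {0..2 ^ n - 1} \<and> 2 ^ n dvd a\<^sup>2 + b\<^sup>2}"

section \<open>Size of the half ideal\<close>

lemma finite_half_ideal: "finite (half_ideal n)"
  by (rule finite_subset[of _ "{0..2 ^ n - 1} \<times> {0..2 ^ n - 1}"]) (auto simp: half_ideal_def)

text \<open>The interval consists of \<open>k\<close> blocks of length \<open>q\<close>, each
  meeting the residue class of \<open>a\<close> once; block \<open>t\<close> does so in
  \<open>a mod q + q * int t\<close>.\<close>

lemma card_dvd_diff_interval: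
  fixes q :: int
  assumes "q > 0"
  shows "card {b \<in> {0..<q * int k}. q dvd a - b} = k"
proof -
  have "bij_betw (\<lambda>t. a mod q + q * int t) {..<k} {b \<in> {0..<q * int k}. q dvd a - b}"
  proof (rule bij_betw_byWitness[where f' = "\<lambda>b. nat (b div q)"])
    show "\<forall>t\<in>{..<k}. nat ((a mod q + q * int t) div q) = t"
      using assms by simp
    show "\<forall>b\<in>{b \<in> {0..<q * int k}. q dvd a - b}. a mod q + q * int (nat (b div q)) = b"
      using assms by (auto simp: mod_eq_dvd_iff[symmetric] pos_imp_zdiv_nonneg_iff)
    show "(\<lambda>t. a mod q + q * int t) ` {..<k} \<subseteq> {b \<in> {0..<q * int k}. q dvd a - b}"
    proof safe
      fix t assume "t < k"
      then have "q * int (Suc t) \<le> q * int k"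
        using assms by (intro mult_left_mono) auto
      moreover have "0 \<le> a mod q" "a mod q < q"
        using assms by auto
      moreover have "0 \<le> q * int t"
        using assms by simp
      ultimately show "a mod q + q * int t \<in> {0..<q * int k}"
        by (simp add: algebra_simps)
      show "q dvd a - (a mod q + q * int t)"
        by (simp add: mod_eq_dvd_iff[symmetric])
    qed
    show "(\<lambda>b. nat (b div q)) ` {b \<in> {0..<q * int k}. q dvd a - b} \<subseteq> {..<k}"
    proof safe
      fix b assume "b \<in> {0..<q * int k}"
      then have "q * (b div q) < q * int k"
        using mult_div_mod_eq[of q b] pos_mod_sign[OF assms, of b]
        unfolding atLeastLessThan_iff by linarith
      then have "b div q < int k"
        using assms by (simp only: mult_less_cancel_left_pos)
      then show "nat (b div q) < k"
        using assms \<open>b \<in> _\<close> by (simp add: nat_less_iff pos_imp_zdiv_nonneg_iff)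
    qed
  qed
  from bij_betw_same_card[OF this] show ?thesis
    by simp
qed

text \<open>Count pairs by first coordinate: \<open>2 ^ (n - n div 2)\<close> choices of
  \<open>a\<close>, each with \<open>2 ^ (n div 2)\<close> choices of \<open>b\<close>.\<close>

lemma card_half_ideal: "card (half_ideal n) = 2 ^ n"
proof -
  let ?m = "n div 2"
  let ?K = "n - n div 2"
  \<comment> \<open>The form \<open>0 - a\<close> makes this an instance of the residue class
    count.\<close>
  let ?A = "{a \<in> {0..<2 ^ n}. (2::int) ^ ?m dvd 0 - a}"
  let ?B = "\<lambda>a. {b \<in> {0..<2 ^ n}. (2::int) ^ ?K dvd a - b}"
  have split: "(2::int) ^ ?m * int (2 ^ ?K) = 2 ^ n" "(2::int) ^ ?K * int (2 ^ ?m) = 2 ^ n"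
    by (simp_all flip: power_add)
  have A: "card ?A = 2 ^ ?K"
    using card_dvd_diff_interval[of "2 ^ ?m" "2 ^ ?K" 0] unfolding split by simp
  have B: "card (?B a) = 2 ^ ?m" for a
    using card_dvd_diff_interval[of "2 ^ ?K" "2 ^ ?m" a] unfolding split by simp
  have "half_ideal n = Sigma ?A ?B"
    by (auto simp: half_ideal_def power_two_dvd_norm_iff)
  then have "card (half_ideal n) = card (Sigma ?A ?B)"
    by (rule arg_cong)
  also have "\<dots> = (\<Sum>a\<in>?A. card (?B a))"
    by (rule card_SigmaI) (auto intro: finite_subset[of _ "{0..<2 ^ n}"])
  also have "\<dots> = 2 ^ ?K * 2 ^ ?m"
    by (simp only: B sum_constant A of_nat_id)
  finally show ?thesis
    by (simp flip: power_add)
qed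

section \<open>Annihilation and the half ideal\<close>

lemma half_ideal_mult:
  assumes "n > 0" "x \<in> half_ideal n" "y \<in> half_ideal n"
  shows "x \<otimes>\<^bsub>gaussian_residue_ring (2 ^ n)\<^esub> y = \<zero>\<^bsub>gaussian_residue_ring (2 ^ n)\<^esub>"
proof -
  obtain a b c d where xy: "x = (a, b)" "y = (c, d)"
    by (cases x, cases y)
  have "(2::int) ^ n > 1"
    using assms(1) by simp
  then show ?thesis
    using assms(2,3) gaussian_mult_dvd[of n a b c d]
    unfolding xy by (simp add: half_ideal_def power_two_dvd_norm_iff gaussian_residue_ring_mult_eq_zero_iff)
qed

text \<open>The product of the two norms is divisible by \<open>2 ^ (2 * n)\<close>. As 2 is prime,
  this power is distributed over the two norms, and one of them receives an exponent of at least
  \<open>n\<close>.\<close>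

lemma mult_eq_zero_imp_half_ideal:
  assumes "n > 0"
    and "x \<in> carrier (gaussian_residue_ring (2 ^ n))" "y \<in> carrier (gaussian_residue_ring (2 ^ n))"
    and "x \<otimes>\<^bsub>gaussian_residue_ring (2 ^ n)\<^esub> y = \<zero>\<^bsub>gaussian_residue_ring (2 ^ n)\<^esub>"
  shows "x \<in> half_ideal n \<or> y \<in> half_ideal n"
proof -
  obtain a b c d where xy: "x = (a, b)" "y = (c, d)"
    by (cases x, cases y)
  have "(2 ^ n)\<^sup>2 dvd (a\<^sup>2 + b\<^sup>2) * (c\<^sup>2 + d\<^sup>2)"
    using assms by (intro gaussian_norm_dvd) (auto simp: xy gaussian_residue_ring_mult_eq_zero_iff)
  moreover have "prime_elem (2::int)"
    by simp
  ultimately have "\<exists>i j. i + j = n * 2 \<and> 2 ^ i dvd a\<^sup>2 + b\<^sup>2 \<and> 2 ^ j dvd c\<^sup>2 + d\<^sup>2"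
    by (intro prime_elem_power_dvd_prod) (simp_all add: power_mult)
  then obtain i j where ij: "i + j = n * 2" "2 ^ i dvd a\<^sup>2 + b\<^sup>2" "2 ^ j dvd c\<^sup>2 + d\<^sup>2"
    by blast
  then have "n \<le> i \<or> n \<le> j"
    by auto
  then have "2 ^ n dvd a\<^sup>2 + b\<^sup>2 \<or> 2 ^ n dvd c\<^sup>2 + d\<^sup>2"
    using ij power_le_dvd by blast
  then show ?thesis
    using assms by (auto simp: xy half_ideal_def gaussian_residue_ring_simps)
qed

text \<open>The witness is the \<open>n\<close>-th power of \<pi> up to a unit: \<open>?q\<close>
  for even \<open>n\<close> and \<open>?q * (1 + i)\<close> for odd \<open>n\<close>. It becomes the
  clique vertex whose colour is reused.\<close>

lemma ex_norm_eq_power_two: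
  assumes "n > 0"
  obtains c d :: int where "c \<in> {0..2 ^ n - 1}" "d \<in> {0..2 ^ n - 1}" "c\<^sup>2 + d\<^sup>2 = 2 ^ n"
proof -
  let ?q = "(2::int) ^ (n div 2)"
  have q: "?q < 2 ^ n"
    using assms by (intro power_strict_increasing) auto
  show thesis
  proof (cases "even n")
    case True
    then have "?q\<^sup>2 + 0\<^sup>2 = 2 ^ n"
      by (simp flip: power_mult)
    with q show thesis
      by (intro that[of ?q 0]) auto
  next
    case False
    then have "Suc (n div 2 * 2) = n"
      by presburger
    then have "?q\<^sup>2 + ?q\<^sup>2 = 2 ^ n"
      by (metis power_mult power_Suc mult_2)
    with q show thesis
      by (intro that[of ?q ?q]) auto
  qed
qed

section \<open>The chromatic number\<close>

theorem theorem2p4: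
  fixes n :: nat
  assumes "n > 1"
  shows "chromatic_number (zero_divisor_graph (gaussian_residue_ring (2 ^ n))) = enat (2 ^ n - 1)"
proof -
  let ?R = "gaussian_residue_ring (2 ^ n)"
  let ?I = "half_ideal n - {\<zero>\<^bsub>?R\<^esub>}"
  have n: "n > 0" and m: "(2::int) ^ n > 1"
    using assms by auto
  interpret cring ?R
    using m by (rule cring_gaussian_residue_ring)
  have verts: "nonzero_zero_divisors ?R \<subseteq> carrier ?R"
    by (auto simp: nonzero_zero_divisors_def)
  have I_sub: "?I \<subseteq> nonzero_zero_divisors ?R"
  proof
    fix x assume x: "x \<in> ?I"
    then have "x \<in> carrier ?R - {\<zero>\<^bsub>?R\<^esub>}"
      by (auto simp: half_ideal_def gaussian_residue_ring_simps)
    \<comment> \<open>The square of \<open>x\<close> vanishes, so \<open>x\<close> itself witnesses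
      that it is a zero divisor.\<close>
    then show "x \<in> nonzero_zero_divisors ?R"
      using half_ideal_mult[OF n, of x x] x by (auto simp: nonzero_zero_divisors_def)
  qed
  obtain c d :: int where cd: "c \<in> {0..2 ^ n - 1}" "d \<in> {0..2 ^ n - 1}" "c\<^sup>2 + d\<^sup>2 = 2 ^ n"
    using n by (rule ex_norm_eq_power_two)
  then have p: "(c, d) \<in> ?I"
    by (auto simp: half_ideal_def gaussian_residue_ring_simps)
  \<comment> \<open>The norm of \<open>(c, d)\<close> is exactly \<open>2 ^ n\<close>; cancelling it
    from \<open>2 ^ n * 2 ^ n\<close> leaves a full \<open>2 ^ n\<close> for the norm of
    \<open>x\<close>.\<close>
  have p_annihilator: "x \<in> half_ideal n"
    if x: "x \<in> carrier ?R" and "x \<otimes>\<^bsub>?R\<^esub> (c, d) = \<zero>\<^bsub>?R\<^esub>" for x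
  proof -
    obtain a b where ab: "x = (a, b)"
      by (cases x)
    have "(2 ^ n)\<^sup>2 dvd (a\<^sup>2 + b\<^sup>2) * (c\<^sup>2 + d\<^sup>2)"
      using that m by (intro gaussian_norm_dvd) (auto simp: ab gaussian_residue_ring_mult_eq_zero_iff)
    then have "2 ^ n * 2 ^ n dvd (a\<^sup>2 + b\<^sup>2) * 2 ^ n"
      unfolding cd(3) power2_eq_square[of "2 ^ n"] .
    then have "2 ^ n dvd a\<^sup>2 + b\<^sup>2"
      by simp
    with x show ?thesis
      by (auto simp: ab half_ideal_def gaussian_residue_ring_simps)
  qed
  have nonadj: "x \<otimes>\<^bsub>?R\<^esub> y \<noteq> \<zero>\<^bsub>?R\<^esub>"
    if "x \<in> nonzero_zero_divisors ?R - ?I" "y \<in> insert (c, d) (nonzero_zero_divisors ?R - ?I)"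
    for x y
  proof -
    have "x \<in> carrier ?R" "x \<notin> half_ideal n"
      using that(1) by (auto simp: nonzero_zero_divisors_def)
    moreover have "y = (c, d) \<or> y \<in> carrier ?R \<and> y \<notin> half_ideal n"
      using that(2) by (auto simp: nonzero_zero_divisors_def)
    ultimately show ?thesis
      using p_annihilator mult_eq_zero_imp_half_ideal[OF n] by blast
  qed
  have "chromatic_number (zero_divisor_graph ?R) = enat (card ?I)"
  proof (rule chromatic_number_eq_card_clique[OF _ p])
    fix x y
    assume xy: "x \<in> pverts (zero_divisor_graph ?R) - ?I"
      "y \<in> insert (c, d) (pverts (zero_divisor_graph ?R) - ?I)"
    then have "x \<in> carrier ?R" "y \<in> carrier ?R"
      using verts I_sub p by (auto simp: zero_divisor_graph_def)
    then show "(x, y) \<notin> parcs (zero_divisor_graph ?R) \<and> (y, x) \<notin> parcs (zero_divisor_graph ?R)"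
      using nonadj[of x y] m_comm[of x y] xy by (auto simp: zero_divisor_graph_def)
  next
    fix x y assume "x \<in> ?I" "y \<in> ?I" "x \<noteq> y"
    then show "(x, y) \<in> parcs (zero_divisor_graph ?R)"
      using I_sub half_ideal_mult[OF n, of x y] by (auto simp: zero_divisor_graph_def)
  qed (use I_sub in \<open>auto simp: zero_divisor_graph_def finite_half_ideal\<close>)
  \<comment> \<open>Removing zero from the \<open>2 ^ n\<close> elements accounts for the
    \<open>- 1\<close>.\<close>
  moreover have "\<zero>\<^bsub>?R\<^esub> \<in> half_ideal n"
    by (simp add: half_ideal_def gaussian_residue_ring_simps)
  ultimately show ?thesis
    by (simp add: card_Diff_singleton card_half_ideal)
qed

end
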